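(* Let $c(\Omega)=-\alpha+\mathrm i\beta\Omega$ and let $N>1$ be a sufficiently large integer. Suppose that $\beta>0$ and $$\alpha>\max_{n=1,\dots,N}\max\Big\{\frac{\frac12+\lambda_{i,n}}{\frac12-\lambda_{i,n}}:\ i=\mathbf T,\mathbf M,\mathbf N,\ \lambda_{i,n}\neq\lambda_{\mathbf T,1},\lambda_{\mathbf M,1}\Big\}>0 .$$ **Static resonances.** For $i=\mathbf T,\mathbf M,\mathbf N$ and all $1\le n\le N$ with $\lambda_{i,n}\ne\lambda_{\mathbf T,1},\lambda_{\mathbf M,1}$, the solutions $\Omega_{i,n}=\Omega'_{i,n}+\mathrm i\Omega''_{i,n}$ ($\Omega'_{i,n},\Omega''_{i,n}\in\mathbb{R}$) of $\lambda_{i,n}=\frac{c(\Omega)+1}{2(c(\Omega)-1)}$ satisfy $$\Omega'_{i,n}=0,\qquad\Omega''_{i,n}=\frac{-\alpha(\frac12-\lambda_{i,n})+(\frac12+\lambda_{i,n})}{\beta(\frac12-\lambda_{i,n})}<0.$$ **First-order corrected resonances.** For $\delta\ll1$, the solutions $\Omega_{i,n}(\delta)=\Omega'_{i,n}+\mathrm i\Omega''_{i,n}$ ($\Omega'_{i,n},\Omega''_{i,n}\in\mathbb{R}$) of $$-\tfrac12(c(\Omega)+1)+(c(\Omega)-1)(\lambda_{i,n}+\Omega^2\delta^2\varrho_{i,n})=0$$ satisfy, for all $1\le n\le N$, $i=\mathbf T,\mathbf M,\mathbf N$, writing $\ell=\frac12-\lambda_{i,n}$, $$q_{1}=\frac{3-2(\alpha+1)\ell}{48\beta\delta^2\varrho_{i,n}}-\frac{(\alpha+1)^3}{216\beta^3},\quad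 \Delta_{i,1}=q_1^2+\Big(\frac{\ell}{12\delta^2\varrho_{i,n}}-\frac{(\alpha+1)^2}{36\beta^2}\Big)^3,$$ $$q_{2}=\frac{\alpha\ell-(1+\lambda_{i,n})}{3\beta\delta^2\varrho_{i,n}}+\frac{(\alpha+1)^3}{27\beta^3},\quad \Delta_{i,2}=q_2^2+\Big(\frac{\ell}{3\delta^2\varrho_{i,n}}-\frac{(\alpha+1)^2}{9\beta^2}\Big)^3 :$$ (i) If $\varrho_{i,n}=0$, then for $\lambda_{i,n}\ne\lambda_{\mathbf T,1},\lambda_{\mathbf M,1}$, $\Omega'_{i,n}=0$ and $\Omega''_{i,n}=\frac{-\alpha(\frac12-\lambda_{i,n})+(\frac12+\lambda_{i,n})}{\beta(\frac12-\lambda_{i,n})}$. (ii) If $\varrho_{i,n}>0$, or if $\varrho_{i,n}<0$ and $\lambda_{i,n}=\lambda_{\mathbf T,1}=\lambda_{\mathbf M,1}$, then the solutions are $\Omega_{i,n,k}(\delta)=\Omega'_{i,n,k}+\mathrm i\Omega''_{i,n,k}$, $k=1,2,3$, where $$\Omega''_{i,n,1}=\Omega''_{i,n,2}=\sqrt[3]{-q_1+\sqrt{\Delta_{i,1}}}+\sqrt[3]{-q_1-\sqrt{\Delta_{i,1}}}-\frac{\alpha+1}{3\beta},$$ $$\Omega'_{i,n,1}=-\Omega'_{i,n,2}=\Big(3(\Omega''_{i,n,1})^2+\frac{2(\alpha+1)}{\beta}\Omega''_{i,n,1}+\frac{\ell}{\delta^2\varrho_{i,n}}\Big)^{1/2},$$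 $$\Omega'_{i,n,3}=0,\qquad\Omega''_{i,n,3}=\sqrt[3]{-q_2+\sqrt{\Delta_{i,2}}}+\sqrt[3]{-q_2-\sqrt{\Delta_{i,2}}}-\frac{\alpha+1}{3\beta}.$$ (iii) If $\varrho_{i,n}<0$ and $\lambda_{i,n}\ne\lambda_{\mathbf T,1},\lambda_{\mathbf M,1}$, then the solutions are $\Omega_{i,n,k}(\delta)=\Omega'_{i,n,k}+\mathrm i\Omega''_{i,n,k}$, $k=1,2,3$, with $\Omega'_{i,n,1}=\Omega'_{i,n,2}=\Omega'_{i,n,3}=0$ and $$\Omega''_{i,n,k}=2\sqrt{-\frac{\ell}{3\delta^2\varrho_{i,n}}+\frac{(\alpha+1)^2}{9\beta^2}}\;\cos\Big(\frac{\theta'_i+2(k-1)\pi}{3}\Big)-\frac{\alpha+1}{3\beta},\qquad \theta'_i=\arccos\Bigg(-\frac{q_2}{\big(-\frac{\ell}{3\delta^2\varrho_{i,n}}+\frac{(\alpha+1)^2}{9\beta^2}\big)^{3/2}}\Bigg).$$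
   Context: $\lambda,\mu\in\mathbb{R}$, $\mu>0$, $3\lambda+2\mu>0$; $c_s=\sqrt\mu$, $c_p=\sqrt{\lambda+2\mu}$; $B$ the unit ball centred at the origin of $\mathbb{R}^3$ with exterior unit normal $\boldsymbol\nu$. For $n\ge1$, $$\lambda_{\mathbf T,n}=\tfrac{3}{2(2n+1)},\quad\lambda_{\mathbf M,n}=\tfrac{3\lambda-2\mu(2n^2-2n-3)}{2(\lambda+2\mu)(4n^2-1)},\quad\lambda_{\mathbf N,n}=\tfrac{-3\lambda+2\mu(2n^2+2n-3)}{2(\lambda+2\mu)(4n^2-1)}.$$ These are the eigenvalues of the elastostatic Neumann–Poincaré operator $\mathbf K^*_{\partial B}$ and lie in $(-\frac12,\frac12]$; $\lambda_{\mathbf T,1}=\lambda_{\mathbf M,1}=\frac12$ and all the others are $<\frac12$. The real numbers $\varrho_{i,n}$ are $\varrho_{\mathbf T,n}=\langle\boldsymbol{\mathcal A}_{\partial B,1}[\tilde{\mathbf T}^m_n],\tilde{\mathbf T}^m_n\rangle_{L^2(\partial B)^3}$ and similarly $\varrho_{\mathbf M,n},\varrho_{\mathbf N,n}$ with $\tilde{\mathbf M}^m_n,\tilde{\mathbf N}^m_n$. Here $\boldsymbol{\mathcal A}_{\partial B,1}=(-\frac12\mathbf I+\mathbf K^*_{\partial B})\mathbf S_{\partial B}^{-1}\mathbf P_{\partial B}$, with $\mathbf S_{\partial B}[\boldsymbol\varphi](\boldsymbol x)=\int_{\partial B}\boldsymbol\Gamma^0(\boldsymbol x-\boldsymbol y)\boldsymbol\varphi(\boldsymbol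 y)d\sigma(\boldsymbol y)$ (inverse taken on its range $H^1(\partial B)^3$), $\mathbf K^*_{\partial B}[\boldsymbol\varphi](\boldsymbol x)=\mathrm{p.v.}\int_{\partial B}\frac{\partial}{\partial\boldsymbol\nu_{\boldsymbol x}}\boldsymbol\Gamma^0(\boldsymbol x-\boldsymbol y)\boldsymbol\varphi(\boldsymbol y)d\sigma(\boldsymbol y)$, $\mathbf P_{\partial B}[\boldsymbol\varphi](\boldsymbol x)=\int_{\partial B}\boldsymbol\Lambda(\boldsymbol x-\boldsymbol y)\boldsymbol\varphi(\boldsymbol y)d\sigma(\boldsymbol y)$, where $\boldsymbol\Gamma^0(\boldsymbol x)=-\frac{\gamma_1}{4\pi|\boldsymbol x|}\boldsymbol{\mathcal I}-\frac{\gamma_2}{4\pi}\frac{\boldsymbol x\boldsymbol x^\top}{|\boldsymbol x|^3}$, $\boldsymbol\Lambda(\boldsymbol x)=\frac{\gamma_4}{16\pi}|\boldsymbol x|\boldsymbol{\mathcal I}-\frac{\gamma_5}{16\pi}\frac{\boldsymbol x\boldsymbol x^\top}{|\boldsymbol x|}$, $\gamma_1=\frac12(c_s^{-2}+c_p^{-2})$, $\gamma_2=\frac12(c_s^{-2}-c_p^{-2})$, $\gamma_4=\frac12(3c_s^{-4}+c_p^{-4})$, $\gamma_5=\frac12(c_s^{-4}-c_p^{-4})$, and $\frac{\partial\mathbf u}{\partial\boldsymbol\nu}=\lambda(\nabla\cdot\mathbf u)\boldsymbol\nu+\mu(\nabla\mathbf u+\nabla\mathbf u^\top)\boldsymbol\nu$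 (columnwise for matrices). The functions $\tilde{\mathbf T}^m_n,\tilde{\mathbf M}^m_n$ ($|m|\le n$), $\tilde{\mathbf N}^m_n$ ($|m|\le n-1$) are the $L^2(\partial B)^3$-normalisations of $\nabla_SY_n^m\times\boldsymbol\nu$, $\nabla_SY_n^m+nY_n^m\boldsymbol\nu$, $-\nabla_SY_{n-1}^m+nY_{n-1}^m\boldsymbol\nu$ ($Y_n^m$ spherical harmonics, $\nabla_S$ surface gradient). $\sqrt[3]{\cdot}$ is the real cube root. "$\delta\ll1$" means for all sufficiently small $\delta>0$. *)

theory Defs
  imports "HOL-Analysis.Analysis" "HOL-Computational_Algebra.Polynomial"
begin

section \<open>Surface measure and spherical harmonics on the unit sphere\<close>

text \<open>Spherical coordinates: colatitude in $[0,\pi]$, longitude in $[0,2\pi]$,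
  area element $\sin\vartheta\,d\vartheta\,d\phi$.\<close>

definition sph_coord :: "real \<times> real \<Rightarrow> real^3" where
  "sph_coord = (\<lambda>(t, p). vector [sin t * cos p, sin t * sin p, cos t])"

definition surf :: "(real^3) measure" where
  "surf = distr (density (restrict_space lborel ({0..pi} \<times> {0..2*pi}))
                   (\<lambda>(t, p). ennreal (sin t)))
            borel sph_coord"

text \<open>Standard complex spherical harmonics, written in Cartesian coordinates. For $0 \le m$ this is
  $(-1)^m \sqrt{\frac{2n+1}{4\pi}\frac{(n-m)!}{(n+m)!}}\, P_n^{(m)}(\cos\vartheta)
   \sin^m\vartheta\, e^{im\phi}$, with the Legendre polynomial $P_n$ given by Rodrigues' formula,
  since $x_3 = \cos\vartheta$ and $x_1 + i x_2 = \sin\vartheta\, e^{i\phi}$ on the sphere.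
  Only the values on the sphere, for $|m| \le n$, are meaningful.\<close>

definition legendre :: "nat \<Rightarrow> real poly" where
  "legendre n = smult (1 / (2^n * fact n)) ((pderiv ^^ n) ([:-1, 0, 1:] ^ n))"

definition sph_harm_nonneg :: "nat \<Rightarrow> nat \<Rightarrow> real^3 \<Rightarrow> complex" where
  "sph_harm_nonneg n m x =
     of_real ((-1)^m * sqrt ((2 * real n + 1) / (4 * pi) * (fact (n - m) / fact (n + m)))
              * poly ((pderiv ^^ m) (legendre n)) (x$3))
     * (Complex (x$1) (x$2)) ^ m"

definition sph_harm :: "nat \<Rightarrow> int \<Rightarrow> real^3 \<Rightarrow> complex" where
  "sph_harm n m x =
     (if 0 \<le> m then sph_harm_nonneg n (nat m) x
      else (-1) ^ nat (-m) * cnj (sph_harm_nonneg n (nat (-m)) x))"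

text \<open>Surface gradient at a point of the unit sphere: the gradient of the extension that is
  constant along rays, so that it depends only on the values on the sphere.\<close>

definition surf_grad :: "(real^3 \<Rightarrow> complex) \<Rightarrow> real^3 \<Rightarrow> complex^3" where
  "surf_grad f x = (\<chi> j. frechet_derivative (\<lambda>y. f (y /\<^sub>R norm y)) (at x) (axis j 1))"

definition cvec :: "real^3 \<Rightarrow> complex^3" where
  "cvec x = (\<chi> i. of_real (x$i))"

definition cmat :: "real^3^3 \<Rightarrow> complex^3^3" where
  "cmat A = (\<chi> i j. of_real (A$i$j))"

definition ccross :: "complex^3 \<Rightarrow> complex^3 \<Rightarrow> complex^3" where
  "ccross a b = vector [a$2 * b$3 - a$3 * b$2, a$3 * b$1 - a$1 * b$3, a$1 * b$2 - a$2 * b$1]"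

type_synonym vfield = "real^3 \<Rightarrow> complex^3"

definition L2 :: "vfield set" where
  "L2 = {f \<in> borel_measurable surf. integrable surf (\<lambda>x. (norm (f x))\<^sup>2)}"

definition L2_inner :: "vfield \<Rightarrow> vfield \<Rightarrow> complex" where
  "L2_inner f g = (LINT x|surf. (\<Sum>i\<in>UNIV. f x $ i * cnj (g x $ i)))"

definition normalise :: "vfield \<Rightarrow> vfield" where
  "normalise f = (\<lambda>x. f x /\<^sub>R sqrt (LINT y|surf. (norm (f y))\<^sup>2))"

datatype mode = ModeT | ModeM | ModeN

text \<open>The exterior unit normal of the unit ball at \<open>x\<close> is \<open>x\<close> itself.\<close>

fun vec_harm :: "mode \<Rightarrow> nat \<Rightarrow> int \<Rightarrow> vfield" where
  "vec_harm ModeT n m = (\<lambda>x. ccross (surf_grad (sph_harm n m) x) (cvec x))"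
| "vec_harm ModeM n m =
     (\<lambda>x. surf_grad (sph_harm n m) x + (of_nat n * sph_harm n m x) *s cvec x)"
| "vec_harm ModeN n m =
     (\<lambda>x. - surf_grad (sph_harm (n - 1) m) x + (of_nat n * sph_harm (n - 1) m x) *s cvec x)"

fun mode_orders :: "mode \<Rightarrow> nat \<Rightarrow> int set" where
  "mode_orders ModeT n = {m. \<bar>m\<bar> \<le> int n}"
| "mode_orders ModeM n = {m. \<bar>m\<bar> \<le> int n}"
| "mode_orders ModeN n = {m. \<bar>m\<bar> \<le> int n - 1}"

section \<open>Elastic layer potentials (\<open>lam\<close> and \<open>mu\<close> are the Lam\'e parameters)\<close>

definition c_s :: "real \<Rightarrow> real" where
  "c_s mu = sqrt mu"

definition c_p :: "real \<Rightarrow> real \<Rightarrow> real" where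
  "c_p lam mu = sqrt (lam + 2 * mu)"

definition gamma1 :: "real \<Rightarrow> real \<Rightarrow> real" where
  "gamma1 lam mu = (1 / (c_s mu)^2 + 1 / (c_p lam mu)^2) / 2"

definition gamma2 :: "real \<Rightarrow> real \<Rightarrow> real" where
  "gamma2 lam mu = (1 / (c_s mu)^2 - 1 / (c_p lam mu)^2) / 2"

definition gamma4 :: "real \<Rightarrow> real \<Rightarrow> real" where
  "gamma4 lam mu = (3 / (c_s mu)^4 + 1 / (c_p lam mu)^4) / 2"

definition gamma5 :: "real \<Rightarrow> real \<Rightarrow> real" where
  "gamma5 lam mu = (1 / (c_s mu)^4 - 1 / (c_p lam mu)^4) / 2"

definition outer_sq :: "real^3 \<Rightarrow> real^3^3" where
  "outer_sq x = (\<chi> i j. x$i * x$j)"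

definition Kelvin :: "real \<Rightarrow> real \<Rightarrow> real^3 \<Rightarrow> real^3^3" where
  "Kelvin lam mu x =
     - (gamma1 lam mu / (4 * pi * norm x)) *\<^sub>R mat 1
     - (gamma2 lam mu / (4 * pi)) *\<^sub>R (outer_sq x /\<^sub>R (norm x)^3)"

definition Lambda_kernel :: "real \<Rightarrow> real \<Rightarrow> real^3 \<Rightarrow> real^3^3" where
  "Lambda_kernel lam mu x =
     (gamma4 lam mu / (16 * pi) * norm x) *\<^sub>R mat 1
     - (gamma5 lam mu / (16 * pi)) *\<^sub>R (outer_sq x /\<^sub>R norm x)"

definition conormal :: "real \<Rightarrow> real \<Rightarrow> (real^3 \<Rightarrow> real^3) \<Rightarrow> real^3 \<Rightarrow> real^3 \<Rightarrow> real^3" where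
  "conormal lam mu u nu x =
     (let J = matrix (frechet_derivative u (at x))
      in (lam * trace J) *\<^sub>R nu + mu *\<^sub>R ((J + transpose J) *v nu))"

definition conormal_mat ::
    "real \<Rightarrow> real \<Rightarrow> (real^3 \<Rightarrow> real^3^3) \<Rightarrow> real^3 \<Rightarrow> real^3 \<Rightarrow> real^3^3" where
  "conormal_mat lam mu G nu x = (\<chi> i j. conormal lam mu (\<lambda>z. column j (G z)) nu x $ i)"

definition S_op :: "real \<Rightarrow> real \<Rightarrow> vfield \<Rightarrow> vfield" where
  "S_op lam mu \<phi> x = (LINT y|surf. cmat (Kelvin lam mu (x - y)) *v \<phi> y)"

definition P_op :: "real \<Rightarrow> real \<Rightarrow> vfield \<Rightarrow> vfield" where
  "P_op lam mu \<phi> x = (LINT y|surf. cmat (Lambda_kernel lam mu (x - y)) *v \<phi> y)"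

definition Kstar_op :: "real \<Rightarrow> real \<Rightarrow> vfield \<Rightarrow> vfield" where
  "Kstar_op lam mu \<phi> x =
     Lim (at_right 0) (\<lambda>\<epsilon>. LINT y:{y. \<epsilon> < dist x y}|surf.
        cmat (conormal_mat lam mu (\<lambda>z. Kelvin lam mu (z - y)) x x) *v \<phi> y)"

text \<open>The single layer operator is injective on $L^2$ with range $H^1$; a preimage is therefore
  determined up to a null set, which none of the integrals below can see.\<close>

definition S_inv :: "real \<Rightarrow> real \<Rightarrow> vfield \<Rightarrow> vfield" where
  "S_inv lam mu f = (SOME \<psi>. \<psi> \<in> L2 \<and> (AE x in surf. S_op lam mu \<psi> x = f x))"

definition A1_op :: "real \<Rightarrow> real \<Rightarrow> vfield \<Rightarrow> vfield" where
  "A1_op lam mu \<phi> =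
     (let \<psi> = S_inv lam mu (P_op lam mu \<phi>)
      in (\<lambda>x. - (1/2) *\<^sub>R \<psi> x + Kstar_op lam mu \<psi> x))"

text \<open>The inner product is real and independent of the order \<open>m\<close> because the operator is real and
  commutes with rotations; \<open>Re\<close> only changes the type, and \<open>m\<close> is kept as an argument.\<close>

definition rho :: "real \<Rightarrow> real \<Rightarrow> mode \<Rightarrow> nat \<Rightarrow> int \<Rightarrow> real" where
  "rho lam mu i n m =
     (let v = normalise (vec_harm i n m) in Re (L2_inner (A1_op lam mu v) v))"

section \<open>Neumann--Poincar\'e eigenvalues of the ball\<close>

fun np_eig :: "real \<Rightarrow> real \<Rightarrow> mode \<Rightarrow> nat \<Rightarrow> real" where
  "np_eig lam mu ModeT n = 3 / (2 * (2 * real n + 1))"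
| "np_eig lam mu ModeM n =
     (3 * lam - 2 * mu * (2 * (real n)^2 - 2 * real n - 3))
     / (2 * (lam + 2 * mu) * (4 * (real n)^2 - 1))"
| "np_eig lam mu ModeN n =
     (- 3 * lam + 2 * mu * (2 * (real n)^2 + 2 * real n - 3))
     / (2 * (lam + 2 * mu) * (4 * (real n)^2 - 1))"

definition nonexceptional :: "real \<Rightarrow> real \<Rightarrow> mode \<Rightarrow> nat \<Rightarrow> bool" where
  "nonexceptional lam mu i n \<longleftrightarrow>
     np_eig lam mu i n \<noteq> np_eig lam mu ModeT 1 \<and> np_eig lam mu i n \<noteq> np_eig lam mu ModeM 1"

definition alpha_threshold :: "real \<Rightarrow> real \<Rightarrow> nat \<Rightarrow> real" where
  "alpha_threshold lam mu N =
     (MAX n\<in>{1..N}. Max {(1/2 + np_eig lam mu i n) / (1/2 - np_eig lam mu i n) | i.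
                           nonexceptional lam mu i n})"

section \<open>Resonances\<close>

definition contrast :: "real \<Rightarrow> real \<Rightarrow> complex \<Rightarrow> complex" where
  "contrast \<alpha> \<beta> \<Omega> = - of_real \<alpha> + \<i> * of_real \<beta> * \<Omega>"

text \<open>The condition \<open>contrast \<alpha> \<beta> \<Omega> \<noteq> 1\<close> says that the quotient is defined.\<close>

definition static_solutions :: "real \<Rightarrow> real \<Rightarrow> real \<Rightarrow> complex set" where
  "static_solutions \<alpha> \<beta> l =
     {\<Omega>. contrast \<alpha> \<beta> \<Omega> \<noteq> 1 \<and>
          of_real l = (contrast \<alpha> \<beta> \<Omega> + 1) / (2 * (contrast \<alpha> \<beta> \<Omega> - 1))}"

definition corrected_solutions :: "real \<Rightarrow> real \<Rightarrow> real \<Rightarrow> real \<Rightarrow> real \<Rightarrow> complex set" where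
  "corrected_solutions \<alpha> \<beta> \<delta> l r =
     {\<Omega>. - (1/2) * (contrast \<alpha> \<beta> \<Omega> + 1)
          + (contrast \<alpha> \<beta> \<Omega> - 1) * (of_real l + \<Omega>^2 * of_real \<delta>^2 * of_real r) = 0}"

definition static_im :: "real \<Rightarrow> real \<Rightarrow> real \<Rightarrow> real" where
  "static_im \<alpha> \<beta> l = (- \<alpha> * (1/2 - l) + (1/2 + l)) / (\<beta> * (1/2 - l))"

definition q1 :: "real \<Rightarrow> real \<Rightarrow> real \<Rightarrow> real \<Rightarrow> real \<Rightarrow> real" where
  "q1 \<alpha> \<beta> \<delta> l r =
     (3 - 2 * (\<alpha> + 1) * (1/2 - l)) / (48 * \<beta> * \<delta>^2 * r) - (\<alpha> + 1)^3 / (216 * \<beta>^3)"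

definition Delta1 :: "real \<Rightarrow> real \<Rightarrow> real \<Rightarrow> real \<Rightarrow> real \<Rightarrow> real" where
  "Delta1 \<alpha> \<beta> \<delta> l r =
     (q1 \<alpha> \<beta> \<delta> l r)^2 + ((1/2 - l) / (12 * \<delta>^2 * r) - (\<alpha> + 1)^2 / (36 * \<beta>^2))^3"

definition q2 :: "real \<Rightarrow> real \<Rightarrow> real \<Rightarrow> real \<Rightarrow> real \<Rightarrow> real" where
  "q2 \<alpha> \<beta> \<delta> l r =
     (\<alpha> * (1/2 - l) - (1 + l)) / (3 * \<beta> * \<delta>^2 * r) + (\<alpha> + 1)^3 / (27 * \<beta>^3)"

definition Delta2 :: "real \<Rightarrow> real \<Rightarrow> real \<Rightarrow> real \<Rightarrow> real \<Rightarrow> real" where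
  "Delta2 \<alpha> \<beta> \<delta> l r =
     (q2 \<alpha> \<beta> \<delta> l r)^2 + ((1/2 - l) / (3 * \<delta>^2 * r) - (\<alpha> + 1)^2 / (9 * \<beta>^2))^3"

definition pair_im :: "real \<Rightarrow> real \<Rightarrow> real \<Rightarrow> real \<Rightarrow> real \<Rightarrow> real" where
  "pair_im \<alpha> \<beta> \<delta> l r =
     root 3 (- q1 \<alpha> \<beta> \<delta> l r + sqrt (Delta1 \<alpha> \<beta> \<delta> l r))
     + root 3 (- q1 \<alpha> \<beta> \<delta> l r - sqrt (Delta1 \<alpha> \<beta> \<delta> l r)) - (\<alpha> + 1) / (3 * \<beta>)"

definition pair_re_sq :: "real \<Rightarrow> real \<Rightarrow> real \<Rightarrow> real \<Rightarrow> real \<Rightarrow> real" where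
  "pair_re_sq \<alpha> \<beta> \<delta> l r =
     3 * (pair_im \<alpha> \<beta> \<delta> l r)^2 + 2 * (\<alpha> + 1) / \<beta> * pair_im \<alpha> \<beta> \<delta> l r
     + (1/2 - l) / (\<delta>^2 * r)"

definition single_im :: "real \<Rightarrow> real \<Rightarrow> real \<Rightarrow> real \<Rightarrow> real \<Rightarrow> real" where
  "single_im \<alpha> \<beta> \<delta> l r =
     root 3 (- q2 \<alpha> \<beta> \<delta> l r + sqrt (Delta2 \<alpha> \<beta> \<delta> l r))
     + root 3 (- q2 \<alpha> \<beta> \<delta> l r - sqrt (Delta2 \<alpha> \<beta> \<delta> l r)) - (\<alpha> + 1) / (3 * \<beta>)"

definition trig_base :: "real \<Rightarrow> real \<Rightarrow> real \<Rightarrow> real \<Rightarrow> real \<Rightarrow> real" where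
  "trig_base \<alpha> \<beta> \<delta> l r = - ((1/2 - l) / (3 * \<delta>^2 * r)) + (\<alpha> + 1)^2 / (9 * \<beta>^2)"

definition trig_arg :: "real \<Rightarrow> real \<Rightarrow> real \<Rightarrow> real \<Rightarrow> real \<Rightarrow> real" where
  "trig_arg \<alpha> \<beta> \<delta> l r = - (q2 \<alpha> \<beta> \<delta> l r / trig_base \<alpha> \<beta> \<delta> l r powr (3/2))"

definition trig_im :: "real \<Rightarrow> real \<Rightarrow> real \<Rightarrow> real \<Rightarrow> real \<Rightarrow> nat \<Rightarrow> real" where
  "trig_im \<alpha> \<beta> \<delta> l r k =
     2 * sqrt (trig_base \<alpha> \<beta> \<delta> l r)
       * cos ((arccos (trig_arg \<alpha> \<beta> \<delta> l r) + 2 * (real k - 1) * pi) / 3)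
     - (\<alpha> + 1) / (3 * \<beta>)"

end

theory Submission
  imports Defs "HOL-Real_Asymp.Real_Asymp"
begin

text \<open>
  With $\Omega = i(y - \frac{\alpha+1}{3\beta})$ the corrected resonance equation becomes, for
  $\varrho\neq0$, the real depressed cubic $y^3+3Py+2Q=0$ with $Q=q_2$ and
  $P=\frac{\ell}{3\delta^2\varrho}-\frac{(\alpha+1)^2}{9\beta^2}$, so $\Delta_2=Q^2+P^3$.
  If $\Delta_2\ge0$, Cardano's formula gives a real root $t$ and the pair
  $-\frac t2\pm i\sqrt{\frac34t^2+3P}$; since $q_1=-q_2/8$ and $\Delta_1=\Delta_2/64$, the first
  formula of the statement is Cardano's formula for $-\frac t2$. If $\Delta_2\le0$ and $P<0$, the
  three roots are real and given by the trigonometric formula. As $\delta\to0$, $P$ and $Q$ grow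
  at most like $\delta^{-2}$, so the sign of $\Delta_2$ is that of $P^3$ if $\ell\neq0$, and $Q^2$
  dominates if $\ell=0$.
\<close>

section \<open>The depressed cubic\<close>

lemma root3_eighth: "root 3 (x / 8) = root 3 x / 2" for x :: real
proof -
  have "root 3 ((2::real) ^ 3) = 2"
    by (rule real_root_power_cancel) auto
  then show ?thesis
    by (simp add: real_root_divide)
qed

text \<open>Cardano's substitution: \<open>t\<close> is a sum \<open>A + B\<close> of real cube
  roots with product \<open>- P\<close>. Dividing the cubic by \<open>y - t\<close> leaves a real
  quadratic whose roots form a conjugate pair, because its discriminant is
  \<open>- 3 * (A - B)\<^sup>2\<close>. The case \<open>A = B\<close> gives a double root.\<close>

lemma cardano_roots:
  fixes P Q :: real
  assumes "Q\<^sup>2 + P ^ 3 \<ge> 0"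
  defines "t \<equiv> root 3 (- Q + sqrt (Q\<^sup>2 + P ^ 3)) + root 3 (- Q - sqrt (Q\<^sup>2 + P ^ 3))"
  shows "3 / 4 * t\<^sup>2 + 3 * P \<ge> 0"
    and "y ^ 3 + 3 * of_real P * y + 2 * of_real Q = 0 \<longleftrightarrow>
      y \<in> {Complex (- t / 2) (sqrt (3 / 4 * t\<^sup>2 + 3 * P)),
           Complex (- t / 2) (- sqrt (3 / 4 * t\<^sup>2 + 3 * P)), of_real t}"
proof -
  define D where "D = sqrt (Q\<^sup>2 + P ^ 3)"
  define A B where "A = root 3 (- Q + D)" and "B = root 3 (- Q - D)"
  have t: "t = A + B"
    by (simp add: t_def A_def B_def D_def)
  have A3: "A ^ 3 = - Q + D" and B3: "B ^ 3 = - Q - D"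
    by (simp_all add: A_def B_def odd_real_root_pow)
  have "D\<^sup>2 = Q\<^sup>2 + P ^ 3"
    using assms(1) by (simp add: D_def)
  \<comment> \<open>The radicands are conjugate, so their product is a perfect cube. The real cube
    root is single-valued, which fixes \<open>A * B\<close>.\<close>
  then have "(- Q + D) * (- Q - D) = (- P) ^ 3"
    by (simp add: algebra_simps power2_eq_square)
  then have "A * B = root 3 ((- P) ^ 3)"
    unfolding A_def B_def by (simp only: real_root_mult [symmetric])
  then have AB: "A * B = - P"
    using odd_real_root_power_cancel [of 3 "- P"] by simp
  have sq: "3 / 4 * t\<^sup>2 + 3 * P = 3 / 4 * (A - B)\<^sup>2"
  proof -
    have "P = - (A * B)"
      using AB by simp
    then show ?thesis
      unfolding t by (simp add: power2_eq_square algebra_simps)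
  qed
  show nonneg: "3 / 4 * t\<^sup>2 + 3 * P \<ge> 0"
    unfolding sq by simp
  have "t ^ 3 = A ^ 3 + B ^ 3 + 3 * (A * B) * t"
    unfolding t by (simp add: power3_eq_cube algebra_simps)
  then have root: "2 * Q = - (t ^ 3) - 3 * P * t"
    unfolding A3 B3 AB by simp
  define v where "v = sqrt (3 / 4 * t\<^sup>2 + 3 * P)"
  have v2: "3 * P = v\<^sup>2 - 3 / 4 * t\<^sup>2"
    using nonneg by (simp add: v_def)
  \<comment> \<open>With both coefficients expressed through \<open>t\<close> and \<open>v\<close>,
    the factorisation below is a polynomial identity.\<close>
  have Q2: "2 * Q = - (t * (t\<^sup>2 / 4 + v\<^sup>2))"
    unfolding root v2 by (simp add: power3_eq_cube power2_eq_square algebra_simps)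
  have "y ^ 3 + 3 * of_real P * y + 2 * of_real Q
      = y ^ 3 + of_real (3 * P) * y + of_real (2 * Q)"
    by simp
  also have "\<dots> = (y - Complex (- t / 2) v) * (y - Complex (- t / 2) (- v)) * (y - of_real t)"
    unfolding v2 Q2 Complex_eq
    by (simp add: power3_eq_cube power2_eq_square field_simps)
  finally have "y ^ 3 + 3 * of_real P * y + 2 * of_real Q = 0 \<longleftrightarrow>
      y \<in> {Complex (- t / 2) v, Complex (- t / 2) (- v), of_real t}"
    by auto
  then show "y ^ 3 + 3 * of_real P * y + 2 * of_real Q = 0 \<longleftrightarrow>
      y \<in> {Complex (- t / 2) (sqrt (3 / 4 * t\<^sup>2 + 3 * P)),
           Complex (- t / 2) (- sqrt (3 / 4 * t\<^sup>2 + 3 * P)), of_real t}"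
    by (simp add: v_def)
qed

lemma cos_shifted_third:
  "cos ((\<theta> + 2 * pi) / 3) = - cos (\<theta> / 3) / 2 - sqrt 3 / 2 * sin (\<theta> / 3)"
  "cos ((\<theta> + 4 * pi) / 3) = - cos (\<theta> / 3) / 2 + sqrt 3 / 2 * sin (\<theta> / 3)"
proof -
  have 1: "(\<theta> + 2 * pi) / 3 = \<theta> / 3 + 2 * pi / 3"
    by (simp add: field_simps)
  show "cos ((\<theta> + 2 * pi) / 3) = - cos (\<theta> / 3) / 2 - sqrt 3 / 2 * sin (\<theta> / 3)"
    unfolding 1 cos_add cos_120 sin_120 by simp
  \<comment> \<open>240 degrees is split as 60 plus 180, so that the known values at 60 degrees
    suffice.\<close>
  have 2: "(\<theta> + 4 * pi) / 3 = (\<theta> / 3 + pi / 3) + pi"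
    by (simp add: field_simps)
  show "cos ((\<theta> + 4 * pi) / 3) = - cos (\<theta> / 3) / 2 + sqrt 3 / 2 * sin (\<theta> / 3)"
    unfolding 2 cos_periodic_pi cos_add cos_60 sin_60 by simp
qed

text \<open>Viete's substitution: \<open>y = 2 * R * cos \<phi>\<close> with
  \<open>R = sqrt (- P)\<close> turns the cubic into \<open>cos (3 * \<phi>) = x\<close> by the
  triple angle formula. The sign of the discriminant says \<open>\<bar>Q\<bar> \<le> R ^ 3\<close>,
  which puts \<open>x\<close> into the domain of \<open>arccos\<close>.\<close>

lemma trigonometric_roots:
  fixes P Q :: real and y :: complex
  assumes P: "P < 0" and D: "Q\<^sup>2 + P ^ 3 \<le> 0"
  defines "x \<equiv> - (Q / (- P) powr (3 / 2))"
  defines "\<theta> \<equiv> arccos x"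
  shows "\<bar>x\<bar> \<le> 1"
    and "y ^ 3 + 3 * of_real P * y + 2 * of_real Q = 0 \<longleftrightarrow>
      y \<in> (\<lambda>k. of_real (2 * sqrt (- P) * cos ((\<theta> + 2 * (real k - 1) * pi) / 3))) ` {1, 2, 3}"
proof -
  define R where "R = sqrt (- P)"
  have R: "R > 0" and R2: "R\<^sup>2 = - P"
    using P by (simp_all add: R_def)
  have "(- P) powr (3 / 2) = (R powr 2) powr (3 / 2)"
    using R R2 by (simp add: powr_numeral)
  also have "\<dots> = R ^ 3"
    using R by (simp only: powr_powr) (simp add: powr_numeral)
  finally have x: "x = - (Q / R ^ 3)"
    by (simp add: x_def)
  have "Q\<^sup>2 \<le> (- P) ^ 3"
    using D by simp
  also have "\<dots> = (R ^ 3)\<^sup>2"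
    by (simp add: R2 [symmetric] power_mult [symmetric])
  finally have "\<bar>Q\<bar> \<le> R ^ 3"
    using R abs_le_square_iff [of Q "R ^ 3"] by simp
  then show x1: "\<bar>x\<bar> \<le> 1"
    using R by (simp add: x field_simps)
  define c s where "c = cos (\<theta> / 3)" and "s = sin (\<theta> / 3)"
  have s2: "s\<^sup>2 = 1 - c\<^sup>2"
    by (simp add: c_def s_def sin_squared_eq)
  have "4 * c ^ 3 - 3 * c = cos \<theta>"
    using cos_treble_cos [of "\<theta> / 3"] by (simp add: c_def)
  also have "\<dots> = x"
    using x1 by (simp add: \<theta>_def)
  finally have "R ^ 3 * (4 * c ^ 3 - 3 * c) = - Q"
    using R by (simp add: x)
  then have Q: "Q = R ^ 3 * (3 * c - 4 * c ^ 3)"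
    by (simp add: algebra_simps)
  have P': "P = - (R\<^sup>2)"
    using R2 by simp
  \<comment> \<open>The three candidates in terms of one angle. Comparing their elementary symmetric
    functions with the coefficients also covers coinciding roots.\<close>
  define y1 y2 y3 where "y1 = 2 * R * c" and "y2 = - R * c - R * sqrt 3 * s"
    and "y3 = - R * c + R * sqrt 3 * s"
  have e1: "y1 + y2 + y3 = 0"
    by (simp add: y1_def y2_def y3_def)
  have y23: "y2 * y3 = R\<^sup>2 * (4 * c\<^sup>2 - 3)"
  proof -
    have "y2 * y3 = R\<^sup>2 * (c\<^sup>2 - (sqrt 3)\<^sup>2 * s\<^sup>2)"
      by (simp add: y2_def y3_def power2_eq_square algebra_simps)
    then show ?thesis
      by (simp add: s2 algebra_simps)
  qed
  have e2: "y1 * y2 + y1 * y3 + y2 * y3 = 3 * P"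
  proof -
    have "y2 + y3 = - y1"
      using e1 by linarith
    then have "y1 * y2 + y1 * y3 = - (y1\<^sup>2)"
      by (simp add: power2_eq_square flip: distrib_left)
    then show ?thesis
      by (simp add: y23 P' y1_def power2_eq_square algebra_simps)
  qed
  have e3: "y1 * (y2 * y3) = - 2 * Q"
    unfolding y23 Q y1_def by (simp add: power2_eq_square power3_eq_cube algebra_simps)
  have "(y - of_real y1) * (y - of_real y2) * (y - of_real y3)
      = y ^ 3 - of_real (y1 + y2 + y3) * y\<^sup>2 + of_real (y1 * y2 + y1 * y3 + y2 * y3) * y
        - of_real (y1 * (y2 * y3))"
    by (simp add: power3_eq_cube power2_eq_square algebra_simps)
  also have "\<dots> = y ^ 3 + 3 * of_real P * y + 2 * of_real Q"
    unfolding e1 e2 e3 by simp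
  finally have "y ^ 3 + 3 * of_real P * y + 2 * of_real Q = 0 \<longleftrightarrow>
      y = of_real y1 \<or> y = of_real y2 \<or> y = of_real y3"
    by (metis eq_iff_diff_eq_0 mult_eq_0_iff)
  moreover have "2 * sqrt (- P) * cos ((\<theta> + 2 * (real 1 - 1) * pi) / 3) = y1"
    by (simp add: y1_def R_def c_def)
  moreover have "2 * sqrt (- P) * cos ((\<theta> + 2 * (real 2 - 1) * pi) / 3) = y2"
  proof -
    have "\<theta> + 2 * (real 2 - 1) * pi = \<theta> + 2 * pi"
      by simp
    then show ?thesis
      unfolding y2_def R_def c_def s_def
      by (simp only: cos_shifted_third) (simp add: algebra_simps)
  qed
  moreover have "2 * sqrt (- P) * cos ((\<theta> + 2 * (real 3 - 1) * pi) / 3) = y3"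
  proof -
    have "\<theta> + 2 * (real 3 - 1) * pi = \<theta> + 4 * pi"
      by simp
    then show ?thesis
      unfolding y3_def R_def c_def s_def
      by (simp only: cos_shifted_third) (simp add: algebra_simps)
  qed
  ultimately show "y ^ 3 + 3 * of_real P * y + 2 * of_real Q = 0 \<longleftrightarrow>
      y \<in> (\<lambda>k. of_real (2 * sqrt (- P) * cos ((\<theta> + 2 * (real k - 1) * pi) / 3))) ` {1, 2, 3}"
    by (simp only: image_insert image_empty insert_iff empty_iff) auto
qed

text \<open>The leading power of \<open>k\<close> decides the sign; in the application
  \<open>k\<close> is \<open>1 / \<delta>\<^sup>2\<close>. For \<open>C \<noteq> 0\<close> this is
  the cube. The third part is for \<open>C = 0\<close>, where the cube is a constant, here called
  \<open>D\<close>, and the square wins.\<close>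

lemma eventually_depressed_discriminant:
  fixes A B C D :: real
  shows "C > 0 \<Longrightarrow> \<forall>\<^sub>F k in at_top. (A * k + B)\<^sup>2 + (C * k - D) ^ 3 \<ge> 0"
    and "C < 0 \<Longrightarrow> \<forall>\<^sub>F k in at_top. (A * k + B)\<^sup>2 + (C * k - D) ^ 3 \<le> 0"
    and "A \<noteq> 0 \<Longrightarrow> \<forall>\<^sub>F k in at_top. (A * k + B)\<^sup>2 + D \<ge> 0"
proof -
  show "\<forall>\<^sub>F k in at_top. (A * k + B)\<^sup>2 + (C * k - D) ^ 3 \<ge> 0" if "C > 0"
    using eventually_ge_at_top [of "D / C"]
  proof eventually_elim
    case (elim k)
    then have "C * k - D \<ge> 0"
      using that by (simp add: pos_divide_le_eq mult.commute)
    then show ?case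
      by simp
  qed
  have inv: "((\<lambda>k::real. inverse k) \<longlongrightarrow> 0) at_top"
    by (rule tendsto_inverse_0_at_top) (rule filterlim_ident)
  show "\<forall>\<^sub>F k in at_top. (A * k + B)\<^sup>2 + (C * k - D) ^ 3 \<le> 0" if "C < 0"
  proof -
    \<comment> \<open>The expression divided by \<open>k ^ 3\<close>, whose limit is
      \<open>C ^ 3\<close>.\<close>
    have "((\<lambda>k. (A + B * inverse k)\<^sup>2 * inverse k + (C - D * inverse k) ^ 3)
        \<longlongrightarrow> (A + B * 0)\<^sup>2 * 0 + (C - D * 0) ^ 3) at_top"
      by (intro tendsto_intros inv)
    then have "\<forall>\<^sub>F k in at_top. (A + B * inverse k)\<^sup>2 * inverse k + (C - D * inverse k) ^ 3 < 0"
      by (rule order_tendstoD(2)) (use that in simp)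
    then show ?thesis
      using eventually_gt_at_top [of 0]
    proof eventually_elim
      case (elim k)
      have "(A * k + B)\<^sup>2 + (C * k - D) ^ 3
          = k ^ 3 * ((A + B * inverse k)\<^sup>2 * inverse k + (C - D * inverse k) ^ 3)"
        using elim(2) by (simp add: field_simps power2_eq_square power3_eq_cube)
      also have "\<dots> \<le> 0"
        using elim by (intro mult_nonneg_nonpos) auto
      finally show ?case .
    qed
  qed
  show "\<forall>\<^sub>F k in at_top. (A * k + B)\<^sup>2 + D \<ge> 0" if "A \<noteq> 0"
  proof -
    \<comment> \<open>Now division by \<open>k\<^sup>2\<close>, with limit
      \<open>A\<^sup>2\<close>.\<close>
    have "((\<lambda>k. (A + B * inverse k)\<^sup>2 + D * (inverse k)\<^sup>2)
        \<longlongrightarrow> (A + B * 0)\<^sup>2 + D * 0\<^sup>2) at_top"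
      by (intro tendsto_intros inv)
    then have "\<forall>\<^sub>F k in at_top. (A + B * inverse k)\<^sup>2 + D * (inverse k)\<^sup>2 > 0"
      by (rule order_tendstoD(1)) (use that in simp)
    then show ?thesis
      using eventually_gt_at_top [of 0]
    proof eventually_elim
      case (elim k)
      have "(A * k + B)\<^sup>2 + D
          = k\<^sup>2 * ((A + B * inverse k)\<^sup>2 + D * (inverse k)\<^sup>2)"
        using elim(2) by (simp add: field_simps power2_eq_square power3_eq_cube)
      also have "\<dots> \<ge> 0"
        using elim by (intro mult_nonneg_nonneg) auto
      finally show ?case .
    qed
  qed
qed

section \<open>Solutions of the resonance equations\<close>

text \<open>Clearing the denominator of the static equation gives the corrected one with zero
  correction. Both are linear in \<open>\<Omega>\<close>, with leading coefficient nonzero because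
  \<open>l \<noteq> 1 / 2\<close>.\<close>

lemma static_solutions_eq:
  assumes "\<beta> \<noteq> 0" "l \<noteq> 1 / 2"
  shows "static_solutions \<alpha> \<beta> l = {Complex 0 (static_im \<alpha> \<beta> l)}"
    and "corrected_solutions \<alpha> \<beta> \<delta> l 0 = {Complex 0 (static_im \<alpha> \<beta> l)}"
proof -
  have lin: "- (1/2) * (contrast \<alpha> \<beta> \<Omega> + 1) + (contrast \<alpha> \<beta> \<Omega> - 1) * of_real l = 0 \<longleftrightarrow>
      \<Omega> = Complex 0 (static_im \<alpha> \<beta> l)" for \<Omega>
    using assms by (auto simp: contrast_def static_im_def complex_eq_iff field_simps)
  show "corrected_solutions \<alpha> \<beta> \<delta> l 0 = {Complex 0 (static_im \<alpha> \<beta> l)}"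
    unfolding corrected_solutions_def using lin by auto
  \<comment> \<open>At \<open>c = 1\<close> the cleared equation reads \<open>- 1 = 0\<close>, so
    clearing adds no solution.\<close>
  have "c \<noteq> 1 \<and> of_real l = (c + 1) / (2 * (c - 1)) \<longleftrightarrow>
      - (1/2) * (c + 1) + (c - 1) * of_real l = 0" for c :: complex
    by (cases "c = 1") (auto simp: field_simps)
  then show "static_solutions \<alpha> \<beta> l = {Complex 0 (static_im \<alpha> \<beta> l)}"
    unfolding static_solutions_def using lin by auto
qed

lemma static_im_neg:
  assumes "\<beta> > 0" "l < 1 / 2" "\<alpha> > (1/2 + l) / (1/2 - l)"
  shows "static_im \<alpha> \<beta> l < 0"
proof -
  have "1/2 + l < \<alpha> * (1/2 - l)"
    using assms(2,3) by (simp add: pos_divide_less_eq)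
  then show ?thesis
    using assms unfolding static_im_def by (intro divide_neg_pos mult_pos_pos) auto
qed

text \<open>The factor \<open>\<i>\<close> makes the coefficients real and the shift by
  \<open>a\<close> removes the quadratic term. What results is the depressed cubic times
  \<open>\<beta> * \<delta>\<^sup>2 * r\<close>, which is nonzero.\<close>

lemma corrected_solutions_iff:
  fixes \<alpha> \<beta> \<delta> l r :: real
  assumes "\<beta> \<noteq> 0" "\<delta> \<noteq> 0" "r \<noteq> 0"
  defines "P \<equiv> (1/2 - l) / (3 * \<delta>\<^sup>2 * r) - (\<alpha> + 1)\<^sup>2 / (9 * \<beta>\<^sup>2)"
  defines "Q \<equiv> q2 \<alpha> \<beta> \<delta> l r"
  defines "a \<equiv> (\<alpha> + 1) / (3 * \<beta>)"
  shows "\<i> * (y - of_real a) \<in> corrected_solutions \<alpha> \<beta> \<delta> l r \<longleftrightarrow>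
    y ^ 3 + 3 * of_real P * y + 2 * of_real Q = 0"
proof -
  define k where "k = \<delta>\<^sup>2 * r"
  have k: "k \<noteq> 0"
    using assms by (simp add: k_def)
  \<comment> \<open>Eliminating \<open>\<alpha>\<close> turns the quadratic coefficient
    \<open>(\<alpha> + 1) * k\<close> into \<open>3 * \<beta> * k * a\<close>, as in the expansion
    of \<open>\<beta> * k * (w + a) ^ 3\<close>.\<close>
  have \<alpha>: "\<alpha> = 3 * \<beta> * a - 1"
    using assms(1) by (simp add: a_def)
  have P: "k * (3 * P) = (1/2 - l) - 3 * k * a\<^sup>2"
    using assms(1) k unfolding P_def a_def k_def
    by (simp add: field_simps power2_eq_square)
  have Q: "\<beta> * k * (2 * Q) = 2 / 3 * (\<alpha> * (1/2 - l) - (1 + l)) + 2 * \<beta> * k * a ^ 3"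
    using assms(1) k unfolding Q_def q2_def a_def k_def
    by (simp add: field_simps power3_eq_cube)
  define w where "w = y - of_real a"
  have y: "y = w + of_real a"
    by (simp add: w_def)
  have "- (1/2) * (contrast \<alpha> \<beta> (\<i> * w) + 1)
          + (contrast \<alpha> \<beta> (\<i> * w) - 1) * (of_real l + (\<i> * w)^2 * of_real \<delta>^2 * of_real r)
      = - (1/2) * (1 - of_real \<alpha> - of_real \<beta> * w)
        - (of_real \<alpha> + 1 + of_real \<beta> * w) * (of_real l - of_real k * w\<^sup>2)"
    by (simp add: contrast_def k_def power_mult_distrib algebra_simps)
  also have "\<dots> = of_real (\<beta> * k) * y ^ 3 + of_real \<beta> * of_real (k * (3 * P)) * y
      + of_real (\<beta> * k * (2 * Q))"
    unfolding P Q y \<alpha> by (simp add: power3_eq_cube power2_eq_square field_simps)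
  also have "\<dots> = of_real (\<beta> * k) * (y ^ 3 + 3 * of_real P * y + 2 * of_real Q)"
    by (simp add: algebra_simps)
  finally show ?thesis
    using assms(1) k unfolding corrected_solutions_def w_def [symmetric] mem_Collect_eq
    by (simp only: mult_eq_0_iff of_real_eq_0_iff simp_thms)
qed

text \<open>The affine substitution is a bijection of the complex plane, so it carries the root set
  of the cubic onto the solution set.\<close>

lemma corrected_solutions_eq_image:
  assumes "\<beta> \<noteq> 0" "\<delta> \<noteq> 0" "r \<noteq> 0"
    and "\<And>y. y ^ 3 + 3 * of_real ((1/2 - l) / (3 * \<delta>\<^sup>2 * r) - (\<alpha> + 1)\<^sup>2 / (9 * \<beta>\<^sup>2)) * y
            + 2 * of_real (q2 \<alpha> \<beta> \<delta> l r) = 0 \<longleftrightarrow> y \<in> Y"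
  shows "corrected_solutions \<alpha> \<beta> \<delta> l r
    = (\<lambda>y. \<i> * (y - of_real ((\<alpha> + 1) / (3 * \<beta>)))) ` Y"
proof -
  let ?f = "\<lambda>y. \<i> * (y - of_real ((\<alpha> + 1) / (3 * \<beta>)))"
  have mem: "?f y \<in> corrected_solutions \<alpha> \<beta> \<delta> l r \<longleftrightarrow> y \<in> Y" for y
    using corrected_solutions_iff [OF assms(1-3)] assms(4) by simp
  have "\<Omega> \<in> ?f ` Y" if "\<Omega> \<in> corrected_solutions \<alpha> \<beta> \<delta> l r" for \<Omega>
  proof (rule image_eqI)
    show \<Omega>: "\<Omega> = ?f (- \<i> * \<Omega> + of_real ((\<alpha> + 1) / (3 * \<beta>)))"
      by (simp flip: mult.assoc)
    show "- \<i> * \<Omega> + of_real ((\<alpha> + 1) / (3 * \<beta>)) \<in> Y"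
      using that by (subst mem [symmetric], subst \<Omega> [symmetric])
  qed
  then show ?thesis
    using mem by blast
qed

text \<open>The numerators are proportional because \<open>1 + l = 3/2 - (1/2 - l)\<close>.
  Vanishing denominators are covered by the convention \<open>x / 0 = 0\<close>.\<close>

lemma q1_eq: "q1 \<alpha> \<beta> \<delta> l r = - q2 \<alpha> \<beta> \<delta> l r / 8"
  by (cases "\<beta> = 0"; cases "\<delta> = 0"; cases "r = 0")
    (simp_all add: q1_def q2_def field_simps)

lemma Delta1_eq: "Delta1 \<alpha> \<beta> \<delta> l r = Delta2 \<alpha> \<beta> \<delta> l r / 64"
proof -
  have quarter: "(1/2 - l) / (12 * \<delta>^2 * r) - (\<alpha> + 1)^2 / (36 * \<beta>^2)
      = ((1/2 - l) / (3 * \<delta>^2 * r) - (\<alpha> + 1)^2 / (9 * \<beta>^2)) / 4"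
    by (simp add: diff_divide_distrib)
  show ?thesis
    unfolding Delta1_def Delta2_def q1_eq quarter by (simp add: power_divide add_divide_distrib)
qed

lemma corrected_solutions_cardano:
  assumes "\<beta> \<noteq> 0" "\<delta> \<noteq> 0" "r \<noteq> 0" and D: "Delta2 \<alpha> \<beta> \<delta> l r \<ge> 0"
  shows "pair_re_sq \<alpha> \<beta> \<delta> l r \<ge> 0"
    and "corrected_solutions \<alpha> \<beta> \<delta> l r =
               {Complex (sqrt (pair_re_sq \<alpha> \<beta> \<delta> l r)) (pair_im \<alpha> \<beta> \<delta> l r),
                Complex (- sqrt (pair_re_sq \<alpha> \<beta> \<delta> l r)) (pair_im \<alpha> \<beta> \<delta> l r),
                Complex 0 (single_im \<alpha> \<beta> \<delta> l r)}"
proof -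
  define a where "a = (\<alpha> + 1) / (3 * \<beta>)"
  define P where "P = (1/2 - l) / (3 * \<delta>\<^sup>2 * r) - (\<alpha> + 1)\<^sup>2 / (9 * \<beta>\<^sup>2)"
  define Q where "Q = q2 \<alpha> \<beta> \<delta> l r"
  have Delta2: "Delta2 \<alpha> \<beta> \<delta> l r = Q\<^sup>2 + P ^ 3"
    by (simp add: Delta2_def P_def Q_def)
  define t where "t = root 3 (- Q + sqrt (Q\<^sup>2 + P ^ 3)) + root 3 (- Q - sqrt (Q\<^sup>2 + P ^ 3))"
  note roots = cardano_roots [OF D [unfolded Delta2], folded t_def]
  have single: "single_im \<alpha> \<beta> \<delta> l r = t - a"
    by (simp add: single_im_def Delta2 a_def t_def Q_def)
  have pair: "pair_im \<alpha> \<beta> \<delta> l r = - t / 2 - a"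
  proof -
    have sqrt_Delta1: "sqrt (Delta1 \<alpha> \<beta> \<delta> l r) = sqrt (Q\<^sup>2 + P ^ 3) / 8"
      using real_sqrt_abs [of 8] by (simp add: Delta1_eq Delta2 real_sqrt_divide)
    \<comment> \<open>Since \<open>- q1\<close> is \<open>Q / 8\<close>, the two radicands are those
      of \<open>t\<close>, swapped, negated and divided by 8.\<close>
    have "pair_im \<alpha> \<beta> \<delta> l r = root 3 (- (- Q - sqrt (Q\<^sup>2 + P ^ 3)) / 8)
        + root 3 (- (- Q + sqrt (Q\<^sup>2 + P ^ 3)) / 8) - a"
      unfolding pair_im_def sqrt_Delta1 q1_eq
      by (simp add: Q_def a_def add_divide_distrib diff_divide_distrib)
    then show ?thesis
      unfolding root3_eighth real_root_minus by (simp add: t_def)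
  qed
  have re: "pair_re_sq \<alpha> \<beta> \<delta> l r = 3 / 4 * t\<^sup>2 + 3 * P"
  proof -
    \<comment> \<open>This completes the square: \<open>pair_re_sq\<close> becomes
      \<open>3 * (pair_im + a)\<^sup>2 + 3 * P\<close>, and \<open>pair_im + a\<close> is
      \<open>- t / 2\<close>.\<close>
    have "(1/2 - l) / (\<delta>\<^sup>2 * r) = 3 * P + 3 * a\<^sup>2"
      using assms(1-3) by (simp add: P_def a_def power2_eq_square field_simps)
    moreover have "2 * (\<alpha> + 1) / \<beta> = 6 * a"
      using assms(1) by (simp add: a_def field_simps)
    ultimately show ?thesis
      by (simp add: pair_re_sq_def pair power2_eq_square algebra_simps)
  qed
  show "pair_re_sq \<alpha> \<beta> \<delta> l r \<ge> 0"
    using roots(1) by (simp add: re)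
  have "corrected_solutions \<alpha> \<beta> \<delta> l r = (\<lambda>y. \<i> * (y - of_real a)) `
      {Complex (- t / 2) (sqrt (3 / 4 * t\<^sup>2 + 3 * P)),
       Complex (- t / 2) (- sqrt (3 / 4 * t\<^sup>2 + 3 * P)), of_real t}"
    using roots(2) unfolding a_def P_def Q_def
    by (intro corrected_solutions_eq_image assms)
  \<comment> \<open>Multiplication by \<open>\<i>\<close> sends imaginary part \<open>v\<close> to
    real part \<open>- v\<close>, so the pair appears in reversed order.\<close>
  also have "\<dots> = {Complex (- sqrt (pair_re_sq \<alpha> \<beta> \<delta> l r)) (pair_im \<alpha> \<beta> \<delta> l r),
       Complex (sqrt (pair_re_sq \<alpha> \<beta> \<delta> l r)) (pair_im \<alpha> \<beta> \<delta> l r),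
       Complex 0 (single_im \<alpha> \<beta> \<delta> l r)}"
    unfolding image_insert image_empty re pair single
    by (intro arg_cong2 [where f = insert] refl) (simp_all add: complex_eq_iff)
  finally show "corrected_solutions \<alpha> \<beta> \<delta> l r =
               {Complex (sqrt (pair_re_sq \<alpha> \<beta> \<delta> l r)) (pair_im \<alpha> \<beta> \<delta> l r),
                Complex (- sqrt (pair_re_sq \<alpha> \<beta> \<delta> l r)) (pair_im \<alpha> \<beta> \<delta> l r),
                Complex 0 (single_im \<alpha> \<beta> \<delta> l r)}"
    by (simp add: insert_commute)
qed

lemma corrected_solutions_trigonometric:
  assumes "\<beta> \<noteq> 0" "\<delta> \<noteq> 0" "r \<noteq> 0" and D: "Delta2 \<alpha> \<beta> \<delta> l r \<le> 0"
    and P: "trig_base \<alpha> \<beta> \<delta> l r > 0"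
  shows "\<bar>trig_arg \<alpha> \<beta> \<delta> l r\<bar> \<le> 1"
    and "corrected_solutions \<alpha> \<beta> \<delta> l r = {Complex 0 (trig_im \<alpha> \<beta> \<delta> l r k) | k. k \<in> {1, 2, 3}}"
proof -
  define P where "P = (1/2 - l) / (3 * \<delta>\<^sup>2 * r) - (\<alpha> + 1)\<^sup>2 / (9 * \<beta>\<^sup>2)"
  have base: "trig_base \<alpha> \<beta> \<delta> l r = - P"
    by (simp add: trig_base_def P_def)
  have D': "(q2 \<alpha> \<beta> \<delta> l r)\<^sup>2 + P ^ 3 \<le> 0"
    using D by (simp add: Delta2_def P_def)
  have P0: "P < 0"
    using P base by simp
  note roots = trigonometric_roots [OF P0 D', folded base, folded trig_arg_def]
  show "\<bar>trig_arg \<alpha> \<beta> \<delta> l r\<bar> \<le> 1"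
    by (rule roots(1))
  have "corrected_solutions \<alpha> \<beta> \<delta> l r = (\<lambda>y. \<i> * (y - of_real ((\<alpha> + 1) / (3 * \<beta>)))) `
      (\<lambda>k. of_real (2 * sqrt (trig_base \<alpha> \<beta> \<delta> l r)
        * cos ((arccos (trig_arg \<alpha> \<beta> \<delta> l r) + 2 * (real k - 1) * pi) / 3))) ` {1, 2, 3}"
    by (intro corrected_solutions_eq_image assms) (use roots(2) in \<open>simp only: P_def\<close>)
  also have "\<dots> = (\<lambda>k. Complex 0 (trig_im \<alpha> \<beta> \<delta> l r k)) ` {1, 2, 3}"
    unfolding image_image
    by (intro image_cong refl) (simp add: trig_im_def complex_eq_iff)
  finally show "corrected_solutions \<alpha> \<beta> \<delta> l r
      = {Complex 0 (trig_im \<alpha> \<beta> \<delta> l r k) | k. k \<in> {1, 2, 3}}"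
    by blast
qed

section \<open>Small \<open>\<delta>\<close>\<close>

lemma eventually_Delta2:
  fixes \<alpha> \<beta> l r :: real
  assumes "\<beta> \<noteq> 0" "r \<noteq> 0"
  shows "(1/2 - l) / r > 0 \<Longrightarrow> \<forall>\<^sub>F \<delta> in at_right 0. Delta2 \<alpha> \<beta> \<delta> l r \<ge> 0"
    and "l = 1 / 2 \<Longrightarrow> \<forall>\<^sub>F \<delta> in at_right 0. Delta2 \<alpha> \<beta> \<delta> l r \<ge> 0"
    and "(1/2 - l) / r < 0 \<Longrightarrow> \<forall>\<^sub>F \<delta> in at_right 0. Delta2 \<alpha> \<beta> \<delta> l r \<le> 0"
proof -
  \<comment> \<open>Coefficients of \<open>Delta2\<close> as a polynomial in
    \<open>1 / \<delta>\<^sup>2\<close>. The nested quotient in \<open>C\<close> keeps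
    \<open>(1/2 - l) / r\<close> visible, which is why \<open>divide_divide_eq_left\<close> is
    disabled below.\<close>
  define A B C D where "A = (\<alpha> * (1/2 - l) - (1 + l)) / (3 * \<beta> * r)"
    and "B = (\<alpha> + 1) ^ 3 / (27 * \<beta> ^ 3)" and "C = (1/2 - l) / r / 3"
    and "D = (\<alpha> + 1)\<^sup>2 / (9 * \<beta>\<^sup>2)"
  have lim: "filterlim (\<lambda>\<delta>::real. 1 / \<delta>\<^sup>2) at_top (at_right 0)"
    by real_asymp
  have Delta2: "Delta2 \<alpha> \<beta> \<delta> l r = (A * (1 / \<delta>\<^sup>2) + B)\<^sup>2 + (C * (1 / \<delta>\<^sup>2) - D) ^ 3" for \<delta>
    by (simp add: Delta2_def q2_def A_def B_def C_def D_def mult_ac)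
  show "\<forall>\<^sub>F \<delta> in at_right 0. Delta2 \<alpha> \<beta> \<delta> l r \<ge> 0" if "(1/2 - l) / r > 0"
    unfolding Delta2
    by (rule eventually_compose_filterlim [OF eventually_depressed_discriminant(1) lim])
      (use that in \<open>simp add: C_def del: divide_divide_eq_left\<close>)
  show "\<forall>\<^sub>F \<delta> in at_right 0. Delta2 \<alpha> \<beta> \<delta> l r \<ge> 0" if "l = 1 / 2"
  proof -
    \<comment> \<open>At \<open>l = 1 / 2\<close> the numerator of \<open>A\<close> is
      \<open>- 3 / 2\<close>, whatever \<open>\<alpha>\<close> is.\<close>
    have "C = 0" "A \<noteq> 0"
      using assms unfolding that C_def A_def by simp_all
    then show ?thesis
      unfolding Delta2
      using eventually_compose_filterlim [OF eventually_depressed_discriminant(3) lim, of A B "(- D) ^ 3"]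
      by simp
  qed
  show "\<forall>\<^sub>F \<delta> in at_right 0. Delta2 \<alpha> \<beta> \<delta> l r \<le> 0" if "(1/2 - l) / r < 0"
    unfolding Delta2
    by (rule eventually_compose_filterlim [OF eventually_depressed_discriminant(2) lim])
      (use that in \<open>simp add: C_def del: divide_divide_eq_left\<close>)
qed

section \<open>The Neumann--Poincar\'e eigenvalues\<close>

text \<open>The two exceptional values coincide, so the case distinctions of the theorem reduce to
  whether \<open>l\<close> equals \<open>1 / 2\<close>.\<close>

lemma np_eig_exceptional:
  assumes "lam + 2 * mu > 0"
  shows "np_eig lam mu ModeT 1 = 1 / 2" "np_eig lam mu ModeM 1 = 1 / 2"
  using assms by (simp_all add: field_simps)

text \<open>After clearing positive denominators, each defect is a nonnegative combination of
  \<open>mu\<close> and \<open>3 * lam + 2 * mu\<close>. The bound leaves only the cases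
  \<open>l = 1 / 2\<close> and \<open>l < 1 / 2\<close>.\<close>

lemma np_eig_le_half:
  assumes mu: "mu > 0" and lam: "3 * lam + 2 * mu > 0" and n: "n \<ge> 1"
  shows "np_eig lam mu i n \<le> 1 / 2"
proof -
  define x where "x = real n"
  have x: "x \<ge> 1"
    using n by (simp add: x_def)
  have pos: "lam + 2 * mu > 0"
    using mu lam by simp
  have "4 * x\<^sup>2 - 1 > 0"
    using one_le_power [OF x, of 2] by linarith
  then have den: "2 * (lam + 2 * mu) * (4 * x\<^sup>2 - 1) > 0"
    using pos by (intro mult_pos_pos) auto
  show ?thesis
  proof (cases i)
    case ModeT
    then show ?thesis
      using x by (simp add: x_def field_simps)
  next
    case ModeM
    \<comment> \<open>These two terms add up to three times
      \<open>lam * (x + 1) + mu * (3 * x + 2)\<close>, the cofactor of \<open>4 * (x - 1)\<close> in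
      the defect.\<close>
    have "(3 * lam + 2 * mu) * (x + 1) \<ge> 0" "mu * (7 * x + 4) \<ge> 0"
      using x mu lam by simp_all
    then have "lam * (x + 1) + mu * (3 * x + 2) \<ge> 0"
      by (simp add: algebra_simps)
    then have "4 * (x - 1) * (lam * (x + 1) + mu * (3 * x + 2)) \<ge> 0"
      using x by simp
    then have "3 * lam - 2 * mu * (2 * x\<^sup>2 - 2 * x - 3)
        \<le> 1 / 2 * (2 * (lam + 2 * mu) * (4 * x\<^sup>2 - 1))"
      by (simp add: power2_eq_square algebra_simps)
    then show ?thesis
      using ModeM den by (simp add: x_def pos_divide_le_eq)
  next
    case ModeN
    \<comment> \<open>Integrality enters here: the product is negative for reals strictly between 1
      and 2. Three times the defect is \<open>(3 * lam + 2 * mu) * (4 * x\<^sup>2 + 2) + 4 * mu *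
      ((x - 1) * (x - 2))\<close>.\<close>
    have "(real n - 1) * (real n - 2) \<ge> 0"
      using n by (cases "n = 1") auto
    then have "4 * mu * ((x - 1) * (x - 2)) \<ge> 0"
      using mu by (simp add: x_def)
    moreover have "(3 * lam + 2 * mu) * (4 * x\<^sup>2 + 2) \<ge> 0"
      using lam by (intro mult_nonneg_nonneg [OF less_imp_le]) auto
    ultimately have "- 3 * lam + 2 * mu * (2 * x\<^sup>2 + 2 * x - 3)
        \<le> 1 / 2 * (2 * (lam + 2 * mu) * (4 * x\<^sup>2 - 1))"
      by (simp add: power2_eq_square algebra_simps)
    then show ?thesis
      using ModeN den by (simp add: x_def pos_divide_le_eq)
  qed
qed

section \<open>Finitely many modes and the threshold for \<open>\<alpha>\<close>\<close>

lemma UNIV_mode: "UNIV = {ModeT, ModeM, ModeN}"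
  using mode.exhaust by auto

text \<open>Finiteness lets one bound on \<open>\<delta>\<close> serve all orders
  \<open>m\<close>.\<close>

lemma finite_mode_orders: "finite (mode_orders i n)"
proof -
  have "mode_orders i n \<subseteq> {- int n..int n}"
    by (cases i) auto
  then show ?thesis
    by (rule finite_subset) simp
qed

lemma le_alpha_threshold:
  assumes "n \<in> {1..N}" "nonexceptional lam mu i n"
  shows "(1/2 + np_eig lam mu i n) / (1/2 - np_eig lam mu i n) \<le> alpha_threshold lam mu N"
proof -
  let ?S = "\<lambda>n. {(1/2 + np_eig lam mu i n) / (1/2 - np_eig lam mu i n) | i.
                   nonexceptional lam mu i n}"
  have "?S n \<subseteq> range (\<lambda>i. (1/2 + np_eig lam mu i n) / (1/2 - np_eig lam mu i n))"
    by auto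
  then have "finite (?S n)"
    by (rule finite_subset) (simp add: UNIV_mode)
  then have "(1/2 + np_eig lam mu i n) / (1/2 - np_eig lam mu i n) \<le> Max (?S n)"
    using assms(2) by (intro Max_ge) auto
  also have "\<dots> \<le> alpha_threshold lam mu N"
    unfolding alpha_threshold_def using assms(1) by (intro Max_ge) auto
  finally show ?thesis .
qed

section \<open>Static and corrected resonances of the ball\<close>

theorem proposition4p5:
  fixes lam mu \<alpha> \<beta> :: real and N :: nat
  assumes "mu > 0" and "3 * lam + 2 * mu > 0"
    and "N > 1" and "\<beta> > 0"
    and "\<alpha> > alpha_threshold lam mu N" and "alpha_threshold lam mu N > 0"
  shows
    "(\<forall>i. \<forall>n\<in>{1..N}. nonexceptional lam mu i n \<longrightarrow>
        static_solutions \<alpha> \<beta> (np_eig lam mu i n)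
          = {Complex 0 (static_im \<alpha> \<beta> (np_eig lam mu i n))}
        \<and> static_im \<alpha> \<beta> (np_eig lam mu i n) < 0)
     \<and>
     (\<forall>\<^sub>F \<delta> in at_right 0. \<forall>n\<in>{1..N}. \<forall>i. \<forall>m\<in>mode_orders i n.
        let l = np_eig lam mu i n; r = rho lam mu i n m in
        (r = 0 \<and> nonexceptional lam mu i n \<longrightarrow>
           corrected_solutions \<alpha> \<beta> \<delta> l r = {Complex 0 (static_im \<alpha> \<beta> l)})
        \<and>
        (r > 0 \<or> (r < 0 \<and> l = np_eig lam mu ModeT 1 \<and> l = np_eig lam mu ModeM 1) \<longrightarrow>
           Delta1 \<alpha> \<beta> \<delta> l r \<ge> 0 \<and> Delta2 \<alpha> \<beta> \<delta> l r \<ge> 0 \<and> pair_re_sq \<alpha> \<beta> \<delta> l r \<ge> 0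
           \<and> corrected_solutions \<alpha> \<beta> \<delta> l r =
               {Complex (sqrt (pair_re_sq \<alpha> \<beta> \<delta> l r)) (pair_im \<alpha> \<beta> \<delta> l r),
                Complex (- sqrt (pair_re_sq \<alpha> \<beta> \<delta> l r)) (pair_im \<alpha> \<beta> \<delta> l r),
                Complex 0 (single_im \<alpha> \<beta> \<delta> l r)})
        \<and>
        (r < 0 \<and> nonexceptional lam mu i n \<longrightarrow>
           trig_base \<alpha> \<beta> \<delta> l r > 0 \<and> \<bar>trig_arg \<alpha> \<beta> \<delta> l r\<bar> \<le> 1
           \<and> corrected_solutions \<alpha> \<beta> \<delta> l r =
               {Complex 0 (trig_im \<alpha> \<beta> \<delta> l r k) | k. k \<in> {1, 2, 3}}))"
proof (intro conjI)
  have pos: "lam + 2 * mu > 0"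
    using assms(1,2) by simp
  note exceptional = np_eig_exceptional [OF pos]
  have nonexc: "nonexceptional lam mu i n \<longleftrightarrow> np_eig lam mu i n \<noteq> 1 / 2" for i n
    unfolding nonexceptional_def exceptional by simp
  have le: "np_eig lam mu i n \<le> 1 / 2" if "n \<in> {1..N}" for i n
    using np_eig_le_half [OF assms(1,2)] that by simp
  show "\<forall>i. \<forall>n\<in>{1..N}. nonexceptional lam mu i n \<longrightarrow>
        static_solutions \<alpha> \<beta> (np_eig lam mu i n)
          = {Complex 0 (static_im \<alpha> \<beta> (np_eig lam mu i n))}
        \<and> static_im \<alpha> \<beta> (np_eig lam mu i n) < 0"
  proof (intro allI ballI impI conjI)
    fix i n
    assume n: "n \<in> {1..N}" and i: "nonexceptional lam mu i n"
    have l: "np_eig lam mu i n \<noteq> 1 / 2"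
      using i nonexc by blast
    then show "static_solutions \<alpha> \<beta> (np_eig lam mu i n)
        = {Complex 0 (static_im \<alpha> \<beta> (np_eig lam mu i n))}"
      using assms(4) by (intro static_solutions_eq) auto
    show "static_im \<alpha> \<beta> (np_eig lam mu i n) < 0"
      using le [OF n, of i] l le_alpha_threshold [OF n i] assms(4,5)
      by (intro static_im_neg) auto
  qed
  \<comment> \<open>The corrected part for one eigenvalue \<open>l\<close> and one coefficient
    \<open>r\<close>, with the exceptional values replaced by \<open>1 / 2\<close>. It is proved for
    each fixed pair first.\<close>
  let ?G = "\<lambda>l r \<delta>. (r = 0 \<and> l \<noteq> 1 / 2 \<longrightarrow>
           corrected_solutions \<alpha> \<beta> \<delta> l r = {Complex 0 (static_im \<alpha> \<beta> l)})
        \<and>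
        (r > 0 \<or> (r < 0 \<and> l = 1 / 2) \<longrightarrow>
           Delta1 \<alpha> \<beta> \<delta> l r \<ge> 0 \<and> Delta2 \<alpha> \<beta> \<delta> l r \<ge> 0 \<and> pair_re_sq \<alpha> \<beta> \<delta> l r \<ge> 0
           \<and> corrected_solutions \<alpha> \<beta> \<delta> l r =
               {Complex (sqrt (pair_re_sq \<alpha> \<beta> \<delta> l r)) (pair_im \<alpha> \<beta> \<delta> l r),
                Complex (- sqrt (pair_re_sq \<alpha> \<beta> \<delta> l r)) (pair_im \<alpha> \<beta> \<delta> l r),
                Complex 0 (single_im \<alpha> \<beta> \<delta> l r)})
        \<and>
        (r < 0 \<and> l \<noteq> 1 / 2 \<longrightarrow>
           trig_base \<alpha> \<beta> \<delta> l r > 0 \<and> \<bar>trig_arg \<alpha> \<beta> \<delta> l r\<bar> \<le> 1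
           \<and> corrected_solutions \<alpha> \<beta> \<delta> l r =
               {Complex 0 (trig_im \<alpha> \<beta> \<delta> l r k) | k. k \<in> {1, 2, 3}})"
  have G: "\<forall>\<^sub>F \<delta> in at_right 0. ?G l r \<delta>" if l: "l \<le> 1 / 2" for l r :: real
  proof -
    have \<delta>: "\<forall>\<^sub>F \<delta>::real in at_right 0. \<delta> \<noteq> 0"
      by (simp add: eventually_at_filter)
    have \<beta>: "\<beta> \<noteq> 0"
      using assms(4) by simp
    \<comment> \<open>For \<open>r = 0\<close> and \<open>l = 1 / 2\<close> all three implications
      are vacuous, so the first case need not separate it.\<close>
    consider "r = 0" | "r > 0 \<or> r < 0 \<and> l = 1 / 2" | "r < 0" "l < 1 / 2"
      using l by linarith
    then show ?thesis
    proof cases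
      case 1
      then show ?thesis
        using static_solutions_eq(2) [OF \<beta>] by simp
    next
      case 2
      then have r: "r \<noteq> 0" and neg: "\<not> (r < 0 \<and> l \<noteq> 1 / 2)"
        by auto
      have "\<forall>\<^sub>F \<delta> in at_right 0. Delta2 \<alpha> \<beta> \<delta> l r \<ge> 0"
      proof (cases "l = 1 / 2")
        case False
        then have "(1/2 - l) / r > 0"
          using 2 l by simp
        then show ?thesis
          by (rule eventually_Delta2(1) [OF \<beta> r])
      qed (rule eventually_Delta2(2) [OF \<beta> r])
      with \<delta> show ?thesis
      proof eventually_elim
        case (elim \<delta>)
        then show ?case
          using corrected_solutions_cardano [OF \<beta> elim(1) r elim(2)] r neg
          by (auto simp: Delta1_eq)
      qed
    next
      case 3
      then have r: "r \<noteq> 0" and neg: "\<not> (r > 0 \<or> r < 0 \<and> l = 1 / 2)"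
        by auto
      have C: "(1/2 - l) / r < 0"
        using 3 by (intro divide_pos_neg) auto
      show ?thesis
        using \<delta> eventually_Delta2(3) [OF \<beta> r C, of \<alpha>]
      proof eventually_elim
        case (elim \<delta>)
        have "(1/2 - l) / (3 * \<delta>\<^sup>2 * r) < 0"
          using 3 elim(1) by (intro divide_pos_neg mult_pos_neg) auto
        then have base: "trig_base \<alpha> \<beta> \<delta> l r > 0"
          unfolding trig_base_def by (intro add_pos_nonneg) auto
        show ?case
          using corrected_solutions_trigonometric [OF \<beta> elim(1) r elim(2) base] base r neg
          by blast
      qed
    qed
  qed
  \<comment> \<open>A finite conjunction of eventual statements is eventual. Writing
    \<open>i\<in>UNIV\<close> makes the quantifier over modes a bounded one, so that
    \<open>eventually_ball_finite\<close> applies.\<close>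
  have "\<forall>\<^sub>F \<delta> in at_right 0. \<forall>n\<in>{1..N}. \<forall>i\<in>UNIV. \<forall>m\<in>mode_orders i n.
      ?G (np_eig lam mu i n) (rho lam mu i n m) \<delta>"
    using G [OF le]
    by (intro eventually_ball_finite ballI finite_mode_orders) (auto simp: UNIV_mode)
  then show "\<forall>\<^sub>F \<delta> in at_right 0. \<forall>n\<in>{1..N}. \<forall>i. \<forall>m\<in>mode_orders i n.
        let l = np_eig lam mu i n; r = rho lam mu i n m in
        (r = 0 \<and> nonexceptional lam mu i n \<longrightarrow>
           corrected_solutions \<alpha> \<beta> \<delta> l r = {Complex 0 (static_im \<alpha> \<beta> l)})
        \<and>
        (r > 0 \<or> (r < 0 \<and> l = np_eig lam mu ModeT 1 \<and> l = np_eig lam mu ModeM 1) \<longrightarrow>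
           Delta1 \<alpha> \<beta> \<delta> l r \<ge> 0 \<and> Delta2 \<alpha> \<beta> \<delta> l r \<ge> 0 \<and> pair_re_sq \<alpha> \<beta> \<delta> l r \<ge> 0
           \<and> corrected_solutions \<alpha> \<beta> \<delta> l r =
               {Complex (sqrt (pair_re_sq \<alpha> \<beta> \<delta> l r)) (pair_im \<alpha> \<beta> \<delta> l r),
                Complex (- sqrt (pair_re_sq \<alpha> \<beta> \<delta> l r)) (pair_im \<alpha> \<beta> \<delta> l r),
                Complex 0 (single_im \<alpha> \<beta> \<delta> l r)})
        \<and>
        (r < 0 \<and> nonexceptional lam mu i n \<longrightarrow>
           trig_base \<alpha> \<beta> \<delta> l r > 0 \<and> \<bar>trig_arg \<alpha> \<beta> \<delta> l r\<bar> \<le> 1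
           \<and> corrected_solutions \<alpha> \<beta> \<delta> l r =
               {Complex 0 (trig_im \<alpha> \<beta> \<delta> l r k) | k. k \<in> {1, 2, 3}})"
    unfolding Let_def nonexc exceptional by simp
qed

end
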